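(* Let $K$ be a field and let $a,d\in\mathbb{N}^2$ be linearly independent over $\mathbb{Q}$ such that $\{a,a+d,a+2d,a+3d,a+4d\}$ is a minimal generating set of $S_{a,d,4}=\langle a,a+d,a+2d,a+3d,a+4d\rangle$. Then the Hilbert series of $K[S_{a,d,4}]$ is $$H(K[S_{a,d,4}];\mathbf{t})=\frac{1-\mathbf{t}^{2a+4d}-\sum_{i=2}^{6}\mathbf{t}^{2a+id}+\sum_{i=4}^{8}\mathbf{t}^{3a+id}+\sum_{i=5}^{7}\mathbf{t}^{3a+id}-\sum_{i=7}^{9}\mathbf{t}^{4a+id}}{\prod_{i=0}^{4}(1-\mathbf{t}^{a+id})}.$$
   Context: $\mathbb{N}$ denotes the set of non-negative integers. $\langle a_1,\ldots,a_n\rangle=\{\sum_i\lambda_i a_i\mid \lambda_i\in\mathbb{N}\}$ is the affine semigroup generated by $a_1,\ldots,a_n\in\mathbb{N}^r$. $K[S]=\bigoplus_{s\in S}K\mathbf{t}^s\subseteq K[t_1,\ldots,t_r]$ is the semigroup ring of $S$, where $\mathbf{t}^s=t_1^{s_1}\cdots t_r^{s_r}$. The Hilbert series of $K[S]$ is the formal sum $H(K[S];\mathbf{t})=\sum_{s\in S}\mathbf{t}^s$. *)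

theory Defs
  imports
    "HOL-Library.Product_Plus"
    "HOL-Library.Poly_Mapping"
    "HOL-Computational_Algebra.Formal_Power_Series"
begin

unbundle fps_syntax

definition nsmul :: "nat \<Rightarrow> nat \<times> nat \<Rightarrow> nat \<times> nat"  (infixr \<open>\<cdot>\<close> 75)
  where "n \<cdot> v = (n * fst v, n * snd v)"

definition rat_lin_indep :: "nat \<times> nat \<Rightarrow> nat \<times> nat \<Rightarrow> bool"
  where "rat_lin_indep u v \<longleftrightarrow>
    (\<forall>p q :: rat. p * of_nat (fst u) + q * of_nat (fst v) = 0 \<and>
                  p * of_nat (snd u) + q * of_nat (snd v) = 0 \<longrightarrow> p = 0 \<and> q = 0)"

text \<open>Only meant for finite \<open>A\<close>.\<close>

definition affine_semigroup :: "(nat \<times> nat) set \<Rightarrow> (nat \<times> nat) set"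
  where "affine_semigroup A = {\<Sum>v\<in>A. c v \<cdot> v | c :: nat \<times> nat \<Rightarrow> nat. True}"

definition minimal_generating_set :: "(nat \<times> nat) set \<Rightarrow> (nat \<times> nat) set \<Rightarrow> bool"
  where "minimal_generating_set A S \<longleftrightarrow>
    finite A \<and> affine_semigroup A = S \<and> (\<forall>B. B \<subset> A \<longrightarrow> affine_semigroup B \<noteq> S)"

definition arith_semigroup :: "nat \<times> nat \<Rightarrow> nat \<times> nat \<Rightarrow> nat \<Rightarrow> (nat \<times> nat) set"
  where "arith_semigroup a d k = affine_semigroup ((\<lambda>i. a + i \<cdot> d) ` {0..k})"

text \<open>
  The polynomial ring \<open>K[t\<^sub>1, t\<^sub>2]\<close> is the type \<open>(nat \<times> nat) \<Rightarrow>\<^sub>0 'k\<close>: a polynomial is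
  its finitely supported coefficient function, and the product is convolution over the
  monoid \<open>nat \<times> nat\<close> of exponents.  The subspace \<open>\<Oplus>s\<in>S. K t\<^sup>s\<close> consists of the
  polynomials whose support lies in \<open>S\<close>.
\<close>

definition semigroup_ring :: "(nat \<times> nat) set \<Rightarrow> ((nat \<times> nat) \<Rightarrow>\<^sub>0 'k::field) set"
  where "semigroup_ring S = {p. Poly_Mapping.keys p \<subseteq> S}"

text \<open>
  Power series in \<open>t\<^sub>1, t\<^sub>2\<close> are iterated univariate ones: \<open>f $ i $ j\<close> is the coefficient
  of \<open>t\<^sub>1\<^sup>i t\<^sub>2\<^sup>j\<close>.  The coefficients are rational whatever \<open>K\<close> is; a field is needed
  for the library's division of power series to invert the series with nonzero constant
  term (lemma \<open>fps2_divide_eq_iff\<close> below).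
\<close>

type_synonym fps2 = "rat fps fps"

definition tpow :: "nat \<times> nat \<Rightarrow> fps2"
  where "tpow v = fps_X ^ fst v * fps_const (fps_X ^ snd v)"

text \<open>The formal sum of \<open>tpow s\<close> over a possibly infinite set of exponents.\<close>

definition formal_sum :: "(nat \<times> nat) set \<Rightarrow> fps2"
  where "formal_sum A = Abs_fps (\<lambda>i. Abs_fps (\<lambda>j. if (i, j) \<in> A then 1 else 0))"

text \<open>
  The Hilbert series of a ring spanned by monomials is the formal sum of its monomials;
  for a semigroup ring this is the sum over the semigroup (lemma
  \<open>hilbert_series_semigroup_ring\<close>).
\<close>

definition hilbert_series :: "((nat \<times> nat) \<Rightarrow>\<^sub>0 'k::field) set \<Rightarrow> fps2"
  where "hilbert_series R = formal_sum {s. Poly_Mapping.single s 1 \<in> R}"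

lemma hilbert_series_semigroup_ring:
  "hilbert_series (semigroup_ring S :: ((nat \<times> nat) \<Rightarrow>\<^sub>0 'k::field) set) = formal_sum S"
  by (simp add: hilbert_series_def semigroup_ring_def)

lemma tpow_nth: "tpow v $ i $ j = (if (i, j) = v then 1 else 0)"
  by (cases v) (simp add: tpow_def fps_X_power_mult_nth fps_X_power_nth)

lemma formal_sum_finite: "finite A \<Longrightarrow> formal_sum A = (\<Sum>s\<in>A. tpow s)"
  by (intro fps_ext) (simp add: formal_sum_def fps_sum_nth tpow_nth)

lemma fps2_divide_eq_iff:
  fixes f g h :: fps2
  assumes "g $ 0 $ 0 \<noteq> 0"
  shows "h = f / g \<longleftrightarrow> h * g = f"
proof -
  have "g $ 0 * inverse (g $ 0) = 1"
    by (rule inverse_mult_eq_1'[OF assms])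
  then have inv: "g * inverse g = 1"
    by (subst fps_inverse_def) (rule fps_right_inverse)
  have div: "f / g = f * inverse g"
    by (rule fps_divide_unit) (use assms in auto)
  show ?thesis
  proof
    assume "h = f / g"
    then have "h * g = f * (g * inverse g)"
      by (simp only: div mult_ac)
    then show "h * g = f"
      by (simp only: inv mult_1_right)
  next
    assume "h * g = f"
    then have "f / g = h * (g * inverse g)"
      unfolding div by (metis mult.assoc)
    then show "h = f / g"
      by (simp only: inv mult_1_right)
  qed
qed

end

theory Submission
  imports Defs
begin

text \<open>
  Let \<open>k > 0\<close>, and put \<open>x = tpow a\<close> and \<open>y = tpow d\<close>.
  The semigroup generated by \<open>a, a + d, ..., a + k d\<close>
  consists of the points \<open>n a + i d\<close> with \<open>i \<le> k n\<close> (\<open>arith_semigroup_eq\<close>), and by linear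
  independence \<open>n\<close> and \<open>i\<close> are determined by the point, so the semigroup is a copy of the lattice
  cone \<open>i \<le> k n\<close>.

  Its extremal rays are spanned by \<open>a\<close> and \<open>a + k d\<close>.  The semigroup ring is free over the
  polynomial ring in these two generators: each point is uniquely one of
  \<open>0, a + d, ..., a + (k - 1) d\<close> plus a combination of \<open>a\<close> and \<open>a + k d\<close>.  For the formal sum
  \<open>H\<close> this means \<open>H (1 - x) (1 - x y\<^sup>k) = 1 + \<Sum>i=1..k-1. x y\<^sup>i\<close>
  (\<open>formal_sum_arith_semigroup\<close>).  It is obtained from the observation that multiplying by
  \<open>1 - tpow v\<close> removes from a set stable under translation by \<open>v\<close> the translated copy
  (\<open>formal_sum_times_one_minus_tpow\<close>), used once for each ray.

  For \<open>k = 4\<close>, the numerator in the theorem is the expansion of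
  \<open>(1 + x y + x y\<^sup>2 + x y\<^sup>3) (1 - x y) (1 - x y\<^sup>2) (1 - x y\<^sup>3)\<close>: the remaining three factors
  of the denominator are put in artificially.
\<close>

lemma nsmul_0 [simp]: "0 \<cdot> v = 0"
  by (simp add: nsmul_def zero_prod_def)

lemma nsmul_1 [simp]: "Suc 0 \<cdot> v = v"
  by (simp add: nsmul_def)

lemma nsmul_add_left: "(m + n) \<cdot> v = m \<cdot> v + n \<cdot> v"
  by (simp add: nsmul_def algebra_simps)

section \<open>Monomials and formal sums\<close>

lemma tpow_0 [simp]: "tpow 0 = 1"
  by (simp add: tpow_def)

lemma tpow_add: "tpow (u + v) = tpow u * tpow v"
  by (simp add: tpow_def power_add mult_ac flip: fps_const_mult)

lemma tpow_nsmul: "tpow (n \<cdot> v) = tpow v ^ n"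
proof (induction n)
  case (Suc n)
  then show ?case
    using nsmul_add_left[of 1 n v] by (simp add: tpow_add)
qed simp

lemma tpow_times_formal_sum: "tpow v * formal_sum A = formal_sum ((+) v ` A)"
proof (intro fps_ext)
  fix i j
  obtain p q where v: "v = (p, q)"
    by (cases v)
  have "(i, j) \<in> (+) v ` A \<longleftrightarrow> p \<le> i \<and> q \<le> j \<and> (i - p, j - q) \<in> A"
    unfolding v by (force simp: image_iff)
  then show "(tpow v * formal_sum A) $ i $ j = formal_sum ((+) v ` A) $ i $ j"
    by (simp add: v tpow_def formal_sum_def mult.assoc fps_X_power_mult_nth)
qed

lemma formal_sum_times_one_minus_tpow:
  assumes "(+) v ` A \<subseteq> A"
  shows "formal_sum A * (1 - tpow v) = formal_sum (A - (+) v ` A)"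
proof -
  have "formal_sum (A - (+) v ` A) = formal_sum A - formal_sum ((+) v ` A)"
    using assms by (intro fps_ext) (auto simp: formal_sum_def)
  then show ?thesis
    by (simp add: right_diff_distrib mult.commute[of _ "tpow v"] tpow_times_formal_sum)
qed

section \<open>The semigroup as a lattice cone\<close>

lemma affine_semigroup_incl:
  assumes "finite A" "v \<in> A"
  shows "v \<in> affine_semigroup A"
proof -
  have "(\<Sum>w\<in>A. (if w = v then 1 else 0) \<cdot> w) = (\<Sum>w\<in>A. if w = v then v else 0)"
    by (rule sum.cong) auto
  also have "\<dots> = v"
    using assms by simp
  finally show ?thesis
    unfolding affine_semigroup_def by (auto intro!: exI[of _ "\<lambda>w. if w = v then 1 else 0"])
qed

lemma affine_semigroup_0: "0 \<in> affine_semigroup A"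
  unfolding affine_semigroup_def by (auto intro!: exI[of _ "\<lambda>w. 0"])

lemma affine_semigroup_add:
  assumes "u \<in> affine_semigroup A" "v \<in> affine_semigroup A"
  shows "u + v \<in> affine_semigroup A"
proof -
  obtain c e where "u = (\<Sum>w\<in>A. c w \<cdot> w)" "v = (\<Sum>w\<in>A. e w \<cdot> w)"
    using assms unfolding affine_semigroup_def by auto
  then have "u + v = (\<Sum>w\<in>A. (c w + e w) \<cdot> w)"
    by (simp add: nsmul_add_left sum.distrib)
  then show ?thesis
    unfolding affine_semigroup_def by (auto intro!: exI[of _ "\<lambda>w. c w + e w"])
qed

lemma affine_semigroup_least:
  assumes "0 \<in> M" "\<And>u v. u \<in> M \<Longrightarrow> v \<in> M \<Longrightarrow> u + v \<in> M" "A \<subseteq> M"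
  shows "affine_semigroup A \<subseteq> M"
proof -
  have nsmul: "n \<cdot> v \<in> M" if "v \<in> M" for n v
  proof (induction n)
    case (Suc n)
    then show ?case
      using nsmul_add_left[of 1 n v] assms(2) that by simp
  qed (use assms(1) in simp)
  have "(\<Sum>v\<in>A. c v \<cdot> v) \<in> M" for c
    using \<open>A \<subseteq> M\<close> by (induction A rule: infinite_finite_induct) (auto intro: assms nsmul)
  then show ?thesis
    unfolding affine_semigroup_def by auto
qed

definition lattice_point :: "nat \<times> nat \<Rightarrow> nat \<times> nat \<Rightarrow> nat \<times> nat \<Rightarrow> nat \<times> nat"
  where "lattice_point a d = (\<lambda>(n, i). n \<cdot> a + i \<cdot> d)"

lemma lattice_point_add: "lattice_point a d (p + q) = lattice_point a d p + lattice_point a d q"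
  by (cases p; cases q) (simp add: lattice_point_def nsmul_add_left algebra_simps)

lemma inj_lattice_point:
  assumes "rat_lin_indep a d"
  shows "inj (lattice_point a d)"
proof (rule injI)
  fix p q
  assume eq: "lattice_point a d p = lattice_point a d q"
  obtain n i m j where pq: "p = (n, i)" "q = (m, j)"
    by (cases p; cases q)
  let ?s = "of_nat n - of_nat m :: rat" and ?t = "of_nat i - of_nat j :: rat"
  have "n * fst a + i * fst d = m * fst a + j * fst d"
    "n * snd a + i * snd d = m * snd a + j * snd d"
    using eq by (simp_all add: pq lattice_point_def nsmul_def)
  then have "(of_nat (n * fst a + i * fst d) :: rat) = of_nat (m * fst a + j * fst d)"
    "(of_nat (n * snd a + i * snd d) :: rat) = of_nat (m * snd a + j * snd d)"
    by (simp_all only:)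
  then have "?s * of_nat (fst a) + ?t * of_nat (fst d) = 0"
    "?s * of_nat (snd a) + ?t * of_nat (snd d) = 0"
    by (simp_all add: algebra_simps)
  then have "?s = 0 \<and> ?t = 0"
    using assms unfolding rat_lin_indep_def by blast
  then show "p = q"
    by (simp add: pq)
qed

lemma arith_semigroup_eq:
  "arith_semigroup a d k = lattice_point a d ` {(n, i). i \<le> k * n}" (is "_ = ?M")
proof
  show "arith_semigroup a d k \<subseteq> ?M"
    unfolding arith_semigroup_def
  proof (rule affine_semigroup_least)
    show "0 \<in> ?M"
      by (rule image_eqI[of _ _ "(0, 0)"]) (simp_all add: lattice_point_def)
    show "u + v \<in> ?M" if uv: "u \<in> ?M" "v \<in> ?M" for u v
    proof -
      obtain n i m j where "u = lattice_point a d (n, i)" "i \<le> k * n"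
        "v = lattice_point a d (m, j)" "j \<le> k * m"
        using uv by auto
      then show ?thesis
        by (auto simp: distrib_left simp flip: lattice_point_add intro!: imageI)
    qed
    have "a + i \<cdot> d = lattice_point a d (1, i)" for i
      by (simp add: lattice_point_def)
    then show "(\<lambda>i. a + i \<cdot> d) ` {0..k} \<subseteq> ?M"
      by auto
  qed
next
  have "lattice_point a d (n, i) \<in> arith_semigroup a d k" if "i \<le> k * n" for n i
    using that
  proof (induction n arbitrary: i)
    case 0
    then show ?case
      by (simp add: lattice_point_def arith_semigroup_def affine_semigroup_0)
  next
    case (Suc n)
    \<comment> \<open>Split off the generator with the largest possible multiple of \<open>d\<close>, so that the rest still
      satisfies the bound.\<close>
    define j where "j = min i k"
    have "lattice_point a d (n, i - j) \<in> arith_semigroup a d k"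
      by (rule Suc.IH) (use Suc.prems in \<open>auto simp: j_def min_def\<close>)
    moreover have "a + j \<cdot> d \<in> arith_semigroup a d k"
      unfolding arith_semigroup_def by (rule affine_semigroup_incl) (auto simp: j_def)
    moreover have "lattice_point a d (Suc n, i) = lattice_point a d (n, i - j) + (a + j \<cdot> d)"
      using lattice_point_add[of a d "(n, i - j)" "(1, j)"]
      by (simp add: lattice_point_def j_def)
    ultimately show ?case
      by (simp add: arith_semigroup_def affine_semigroup_add)
  qed
  then show "?M \<subseteq> arith_semigroup a d k"
    by auto
qed

section \<open>The Hilbert series\<close>

text \<open>
  Linear independence lets the translations and set differences be computed in the coordinates
  \<open>(n, i)\<close>.  Removing the translate by \<open>(1, 0)\<close> from the cone leaves the origin and, on each
  line \<open>n > 0\<close>, the last \<open>k\<close> points.  Translating this strip by \<open>(1, k)\<close> maps each line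
  \<open>n > 0\<close> onto the next and the origin to \<open>(1, k)\<close>, so it misses exactly the origin and the
  points \<open>(1, i)\<close> with \<open>0 < i < k\<close>.
\<close>

lemma formal_sum_arith_semigroup:
  assumes indep: "rat_lin_indep a d" and "k > 0"
  shows "formal_sum (arith_semigroup a d k) * (1 - tpow a) * (1 - tpow (a + k \<cdot> d)) =
    1 + (\<Sum>i = 1..<k. tpow (a + i \<cdot> d))"
proof -
  let ?f = "lattice_point a d"
  define C where "C = {(n, i). i \<le> k * n}"
  define U where "U = insert (0, 0) {(n, i). 0 < n \<and> k * (n - 1) < i \<and> i \<le> k * n}"
  note inj = inj_lattice_point[OF indep]
  have gen: "a + i \<cdot> d = ?f (1, i)" for i
    by (simp add: lattice_point_def)
  have translate: "(+) (?f p) ` ?f ` A = ?f ` (+) p ` A" for p A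
    by (simp add: image_image lattice_point_add)
  have step: "formal_sum (?f ` A) * (1 - tpow (?f p)) = formal_sum (?f ` (A - (+) p ` A))"
    if "(+) p ` A \<subseteq> A" for p A
    using formal_sum_times_one_minus_tpow[of "?f p" "?f ` A"] that
    by (simp add: translate image_mono image_set_diff[OF inj])
  have C_sub: "(+) (1, 0) ` C \<subseteq> C"
    by (auto simp: C_def)
  have C_diff: "C - (+) (1, 0) ` C = U"
  proof -
    have "(n, i) \<in> (+) (1, 0) ` C \<longleftrightarrow> 0 < n \<and> i \<le> k * (n - 1)" for n i
      by (cases n) (auto simp: C_def image_iff)
    then show ?thesis
      by (auto simp: C_def U_def)
  qed
  have U_shift: "(n, i) \<in> (+) (1, k) ` U \<longleftrightarrow> 0 < n \<and> k \<le> i \<and> (n - 1, i - k) \<in> U" for n i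
  proof
    assume "0 < n \<and> k \<le> i \<and> (n - 1, i - k) \<in> U"
    then show "(n, i) \<in> (+) (1, k) ` U"
      by (intro image_eqI[of _ _ "(n - 1, i - k)"]) auto
  qed auto
  have U_Suc: "(Suc n, i) \<in> U \<longleftrightarrow> k * n < i \<and> i \<le> k * n + k" for n i
    by (auto simp: U_def)
  have U_0: "(0, i) \<in> U \<longleftrightarrow> i = 0" for i
    by (auto simp: U_def)
  have U_sub: "(+) (1, k) ` U \<subseteq> U"
  proof clarify
    fix n i n' i'
    assume "(n, i) = (1, k) + (n', i')" "(n', i') \<in> U"
    then show "(n, i) \<in> U"
      using \<open>k > 0\<close> by (cases n') (auto simp: U_Suc U_0)
  qed
  have U_diff: "U - (+) (1, k) ` U = insert (0, 0) (Pair 1 ` {1..<k})"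
  proof -
    have "(n, i) \<in> U - (+) (1, k) ` U \<longleftrightarrow> (n, i) = (0, 0) \<or> n = 1 \<and> i \<in> {1..<k}" for n i
    proof (cases n)
      case 0
      then show ?thesis
        unfolding Diff_iff U_shift by (simp add: U_0)
    next
      case (Suc m)
      then show ?thesis
        unfolding Diff_iff U_shift using \<open>k > 0\<close> by (cases m) (auto simp: U_Suc U_0)
    qed
    then show ?thesis
      by (simp only: set_eq_iff split_paired_All) auto
  qed
  have "formal_sum (arith_semigroup a d k) * (1 - tpow a) = formal_sum (?f ` U)"
    using step[OF C_sub, unfolded C_diff] gen[of 0] by (simp add: arith_semigroup_eq flip: C_def)
  also have "\<dots> * (1 - tpow (a + k \<cdot> d)) = formal_sum (?f ` insert (0, 0) (Pair 1 ` {1..<k}))"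
    using step[OF U_sub, unfolded U_diff] by (simp add: gen)
  also have "\<dots> = (\<Sum>p\<in>insert (0, 0) (Pair 1 ` {1..<k}). tpow (?f p))"
    by (subst formal_sum_finite)
      (simp_all add: sum.reindex[OF inj_on_subset[OF inj subset_UNIV]] del: image_insert)
  also have "\<dots> = 1 + (\<Sum>i = 1..<k. tpow (a + i \<cdot> d))"
    by (subst sum.insert) (auto simp: sum.reindex inj_on_def lattice_point_def)
  finally show ?thesis .
qed

theorem proposition5p5:
  fixes a d :: "nat \<times> nat"
  assumes "rat_lin_indep a d"
    and "minimal_generating_set {a, a + d, a + 2 \<cdot> d, a + 3 \<cdot> d, a + 4 \<cdot> d} (arith_semigroup a d 4)"
  shows "hilbert_series (semigroup_ring (arith_semigroup a d 4) :: ((nat \<times> nat) \<Rightarrow>\<^sub>0 'k::field) set) =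
    (1 - tpow (2 \<cdot> a + 4 \<cdot> d)
       - (\<Sum>i = 2..6. tpow (2 \<cdot> a + i \<cdot> d))
       + (\<Sum>i = 4..8. tpow (3 \<cdot> a + i \<cdot> d))
       + (\<Sum>i = 5..7. tpow (3 \<cdot> a + i \<cdot> d))
       - (\<Sum>i = 7..9. tpow (4 \<cdot> a + i \<cdot> d)))
    / (\<Prod>i = 0..4. 1 - tpow (a + i \<cdot> d))"
proof -
  define x y where "x = tpow a" and "y = tpow d"
  define H where "H = formal_sum (arith_semigroup a d 4)"
  have a: "a \<noteq> 0"
  proof
    assume "a = 0"
    then show False
      using assms(1)[unfolded rat_lin_indep_def, rule_format, of 1 0] by simp
  qed
  have monom: "tpow (m \<cdot> a + i \<cdot> d) = x ^ m * y ^ i" "tpow (a + i \<cdot> d) = x * y ^ i" for m i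
    by (simp_all add: x_def y_def tpow_add tpow_nsmul)
  have sums: "(\<Sum>i = 2..6. f i) = f 2 + f 3 + f 4 + f 5 + f 6"
      "(\<Sum>i = 4..8. f i) = f 4 + f 5 + f 6 + f 7 + f 8"
      "(\<Sum>i = 5..7. f i) = f 5 + f 6 + f 7"
      "(\<Sum>i = 7..9. f i) = f 7 + f 8 + f 9" for f :: "nat \<Rightarrow> fps2"
    by (simp_all add: sum.atLeast_Suc_atMost numeral_eq_Suc add.assoc)
  have prod04: "(\<Prod>i = 0..4. f i) = f 0 * f 1 * f 2 * f 3 * f 4" for f :: "nat \<Rightarrow> fps2"
    by (simp add: prod.atLeast_Suc_atMost numeral_eq_Suc mult.assoc)
  have unit: "(\<Prod>i = 0..4. 1 - tpow (a + i \<cdot> d)) $ 0 $ 0 \<noteq> 0"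
  proof -
    have "(1 - tpow (a + i \<cdot> d)) $ 0 $ 0 = 1" for i
      using a by (cases a) (auto simp: tpow_nth nsmul_def zero_prod_def)
    then have "(\<Prod>i\<in>I. 1 - tpow (a + i \<cdot> d)) $ 0 $ 0 = 1" for I
      by (induction I rule: infinite_finite_induct) auto
    then show ?thesis
      by simp
  qed
  have "H * (1 - x) * (1 - x * y ^ 4) = 1 + (x * y + x * y ^ 2 + x * y ^ 3)"
    using formal_sum_arith_semigroup[OF assms(1), of 4]
    by (simp add: H_def x_def monom(2)[unfolded x_def] eval_nat_numeral add_ac)
  moreover have "H * ((1 - x) * (1 - x * y) * (1 - x * y ^ 2) * (1 - x * y ^ 3) * (1 - x * y ^ 4)) =
      H * (1 - x) * (1 - x * y ^ 4) * ((1 - x * y) * (1 - x * y ^ 2) * (1 - x * y ^ 3))"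
    by (simp only: mult_ac)
  ultimately have "H * ((1 - x) * (1 - x * y) * (1 - x * y ^ 2) * (1 - x * y ^ 3) * (1 - x * y ^ 4)) =
      (1 + (x * y + x * y ^ 2 + x * y ^ 3)) * ((1 - x * y) * (1 - x * y ^ 2) * (1 - x * y ^ 3))"
    by (simp only:)
  also have "\<dots> = 1 - x\<^sup>2 * y ^ 4 - (x\<^sup>2 * y\<^sup>2 + x\<^sup>2 * y ^ 3 + x\<^sup>2 * y ^ 4 + x\<^sup>2 * y ^ 5 + x\<^sup>2 * y ^ 6)
      + (x ^ 3 * y ^ 4 + x ^ 3 * y ^ 5 + x ^ 3 * y ^ 6 + x ^ 3 * y ^ 7 + x ^ 3 * y ^ 8)
      + (x ^ 3 * y ^ 5 + x ^ 3 * y ^ 6 + x ^ 3 * y ^ 7)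
      - (x ^ 4 * y ^ 7 + x ^ 4 * y ^ 8 + x ^ 4 * y ^ 9)"
    by algebra
  also have "\<dots> = 1 - tpow (2 \<cdot> a + 4 \<cdot> d)
       - (\<Sum>i = 2..6. tpow (2 \<cdot> a + i \<cdot> d))
       + (\<Sum>i = 4..8. tpow (3 \<cdot> a + i \<cdot> d))
       + (\<Sum>i = 5..7. tpow (3 \<cdot> a + i \<cdot> d))
       - (\<Sum>i = 7..9. tpow (4 \<cdot> a + i \<cdot> d))"
    unfolding monom by (simp only: sums)
  also have "(1 - x) * (1 - x * y) * (1 - x * y ^ 2) * (1 - x * y ^ 3) * (1 - x * y ^ 4) =
      (\<Prod>i = 0..4. 1 - tpow (a + i \<cdot> d))"
    unfolding monom by (simp only: prod04 power_0 power_one_right mult_1_right)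
  finally show ?thesis
    by (simp only: fps2_divide_eq_iff[OF unit] hilbert_series_semigroup_ring H_def)
qed

end
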